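(* Let $P$ be a dcpo. The poset $\mathrm{Cl}(P)$ of all closure operators on $P$ is a complete lattice, and so is the poset $\mathrm{ClSys}(P)$ of all closure systems in $P$. In $\mathrm{Cl}(P)$, the join of a set $G$ of closure operators is the closure operator $\overline{G}$ generated by $G$, while in $\mathrm{ClSys}(P)$ the meet of a set $\mathcal{C}$ of closure systems is the intersection $\bigcap\mathcal{C}$.
   Context: A dcpo is a poset in which every directed (in particular nonempty) subset has a join; no least element is required. A preclosure map on a poset $P$ is a map $f:P\to P$ that is increasing and ascending ($x\le f(x)$ for all $x$); a closure operator on $P$ is an idempotent preclosure map. $\mathrm{Cl}(P)$ is ordered pointwise. A closure system in $P$ is the fixpoint set of some closure operator on $P$ (which it determines uniquely); $\mathrm{ClSys}(P)$ is ordered by inclusion. The intersection of the empty set of subsets of $P$ is by convention $P$. For a set $G$ of preclosure maps on a dcpo $P$, the set $\mathrm{fix}(G)=\{x\in P: g(x)=x\text{ for all }g\in G\}$ is a closure system in $P$; the closure operator $\overline{G}$ generated by $G$ is the closure operator on $P$ with $\mathrm{fix}(\overline{G})=\mathrm{fix}(G)$. *)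

theory Defs
  imports "HOL-Algebra.Complete_Lattice"
begin

definition directed_in :: "('a, 'b) gorder_scheme \<Rightarrow> 'a set \<Rightarrow> bool"
  where "directed_in P D \<longleftrightarrow> D \<subseteq> carrier P \<and> D \<noteq> {} \<and>
           (\<forall>x\<in>D. \<forall>y\<in>D. \<exists>z\<in>D. x \<sqsubseteq>\<^bsub>P\<^esub> z \<and> y \<sqsubseteq>\<^bsub>P\<^esub> z)"

locale dcpo = partial_order P for P (structure) +
  assumes directed_sup_exists: "directed_in P D \<Longrightarrow> \<exists>s. is_lub P s D"

text \<open>
  Maps \<open>P \<rightarrow> P\<close> are represented by functions that are extensional on the carrier,
  so that equality of functions is equality of maps.
\<close>

definition preclosure_maps :: "('a, 'b) gorder_scheme \<Rightarrow> ('a \<Rightarrow> 'a) set"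
  where "preclosure_maps P =
    {f \<in> carrier P \<rightarrow>\<^sub>E carrier P. isotone P P f \<and> (\<forall>x\<in>carrier P. x \<sqsubseteq>\<^bsub>P\<^esub> f x)}"

definition closure_operators :: "('a, 'b) gorder_scheme \<Rightarrow> ('a \<Rightarrow> 'a) set"
  where "closure_operators P = {f \<in> preclosure_maps P. idempotent P f}"

definition closure_systems :: "('a, 'b) gorder_scheme \<Rightarrow> 'a set set"
  where "closure_systems P = fps P ` closure_operators P"

definition Cl :: "('a, 'b) gorder_scheme \<Rightarrow> ('a \<Rightarrow> 'a) gorder"
  where "Cl P = \<lparr>carrier = closure_operators P, eq = (=),
                 le = (\<lambda>f g. \<forall>x\<in>carrier P. f x \<sqsubseteq>\<^bsub>P\<^esub> g x)\<rparr>"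

definition ClSys :: "('a, 'b) gorder_scheme \<Rightarrow> 'a set gorder"
  where "ClSys P = \<lparr>carrier = closure_systems P, eq = (=), le = (\<subseteq>)\<rparr>"

definition common_fixpoints :: "('a, 'b) gorder_scheme \<Rightarrow> ('a \<Rightarrow> 'a) set \<Rightarrow> 'a set"
  where "common_fixpoints P G = {x \<in> carrier P. \<forall>g\<in>G. g x = x}"

text \<open>
  For a set \<open>G\<close> of preclosure maps on a dcpo, this description is satisfied by exactly one
  closure operator; see \<open>generated_closure\<close> below.
\<close>

definition generated_closure_operator ::
    "('a, 'b) gorder_scheme \<Rightarrow> ('a \<Rightarrow> 'a) set \<Rightarrow> 'a \<Rightarrow> 'a"
  where "generated_closure_operator P G =
    (THE c. c \<in> closure_operators P \<and> fps P c = common_fixpoints P G)"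

text \<open>
  Intersection of a set of subsets of \<open>P\<close>; the empty intersection is \<open>P\<close>, not the
  whole type.
\<close>

definition intersection_in :: "('a, 'b) gorder_scheme \<Rightarrow> 'a set set \<Rightarrow> 'a set"
  where "intersection_in P \<C> = {x \<in> carrier P. \<forall>C\<in>\<C>. x \<in> C}"

lemma preclosure_mapsD:
  assumes "f \<in> preclosure_maps P"
  shows "f \<in> carrier P \<rightarrow>\<^sub>E carrier P"
    and "x \<in> carrier P \<Longrightarrow> f x \<in> carrier P"
    and "x \<in> carrier P \<Longrightarrow> x \<sqsubseteq>\<^bsub>P\<^esub> f x"
    and "x \<in> carrier P \<Longrightarrow> y \<in> carrier P \<Longrightarrow> x \<sqsubseteq>\<^bsub>P\<^esub> y \<Longrightarrow> f x \<sqsubseteq>\<^bsub>P\<^esub> f y"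
  using assms by (auto simp: preclosure_maps_def isotone_def)

lemma closure_operators_subset: "closure_operators P \<subseteq> preclosure_maps P"
  by (auto simp: closure_operators_def)

context dcpo
begin

lemma closure_operator_le:
  assumes c: "c \<in> closure_operators P" and d: "d \<in> closure_operators P"
    and sub: "fps P d \<subseteq> fps P c" and x: "x \<in> carrier P"
  shows "c x \<sqsubseteq> d x"
proof -
  have cp: "c \<in> preclosure_maps P" and dp: "d \<in> preclosure_maps P"
    using c d closure_operators_subset by blast+
  note dx = preclosure_mapsD(2)[OF dp x]
  have "d (d x) = d x"
    using d x by (simp add: closure_operators_def idempotent_def eq_is_equal)
  with dx have "d x \<in> fps P d" by (simp add: fps_def eq_is_equal)
  with sub have "c (d x) = d x" by (auto simp: fps_def eq_is_equal)
  moreover have "c x \<sqsubseteq> c (d x)"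
    by (rule preclosure_mapsD(4)[OF cp x dx preclosure_mapsD(3)[OF dp x]])
  ultimately show ?thesis by simp
qed

lemma closure_operator_eqI:
  assumes c: "c \<in> closure_operators P" and d: "d \<in> closure_operators P"
    and eq: "fps P c = fps P d"
  shows "c = d"
proof (rule PiE_ext)
  have cp: "c \<in> preclosure_maps P" and dp: "d \<in> preclosure_maps P"
    using c d closure_operators_subset by blast+
  show "c \<in> carrier P \<rightarrow>\<^sub>E carrier P" "d \<in> carrier P \<rightarrow>\<^sub>E carrier P"
    by (rule preclosure_mapsD(1)[OF cp], rule preclosure_mapsD(1)[OF dp])
  show "c x = d x" if x: "x \<in> carrier P" for x
  proof (rule le_antisym)
    show "c x \<sqsubseteq> d x" by (rule closure_operator_le[OF c d _ x]) (simp add: eq)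
    show "d x \<sqsubseteq> c x" by (rule closure_operator_le[OF d c _ x]) (simp add: eq)
  qed (rule preclosure_mapsD(2)[OF cp x], rule preclosure_mapsD(2)[OF dp x])
qed

lemma ex_closure_operator_common_fixpoints:
  assumes G: "G \<subseteq> preclosure_maps P"
  shows "\<exists>c \<in> closure_operators P. fps P c = common_fixpoints P G"
proof -
  let ?F = "common_fixpoints P G"
  define M where "M = {f \<in> preclosure_maps P. \<forall>z\<in>?F. f z = z}"
  define h where "h = (\<lambda>x\<in>carrier P. SOME s. is_lub P s ((\<lambda>f. f x) ` M))"
  have M_pre: "f \<in> preclosure_maps P" if "f \<in> M" for f
    using that by (simp add: M_def)
  note M_car = preclosure_mapsD(2)[OF M_pre]
    and M_asc = preclosure_mapsD(3)[OF M_pre]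
    and M_iso = preclosure_mapsD(4)[OF M_pre]
  have M_I: "f \<in> M"
    if "f \<in> extensional (carrier P)" "\<And>x. x \<in> carrier P \<Longrightarrow> f x \<in> carrier P"
      "\<And>x. x \<in> carrier P \<Longrightarrow> x \<sqsubseteq> f x"
      "\<And>x y. x \<in> carrier P \<Longrightarrow> y \<in> carrier P \<Longrightarrow> x \<sqsubseteq> y \<Longrightarrow> f x \<sqsubseteq> f y"
      "\<And>z. z \<in> ?F \<Longrightarrow> f z = z" for f
    unfolding M_def preclosure_maps_def isotone_def PiE_def Pi_def
    using that weak_partial_order_axioms by simp
  have F_car: "z \<in> carrier P" if "z \<in> ?F" for z
    using that by (simp add: common_fixpoints_def)
  have comp: "compose (carrier P) f g \<in> M" if f: "f \<in> M" and g: "g \<in> M" for f g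
  proof (rule M_I)
    show "x \<sqsubseteq> compose (carrier P) f g x" if x: "x \<in> carrier P" for x
      using le_trans[OF M_asc[OF g x] M_asc[OF f M_car[OF g x]]] M_car f g x
      by (simp add: compose_def)
    show "compose (carrier P) f g z = z" if "z \<in> ?F" for z
      using that f g F_car by (auto simp: compose_def M_def)
    show "compose (carrier P) f g x \<in> carrier P" if "x \<in> carrier P" for x
      using M_car[OF f M_car[OF g that]] that by (simp add: compose_def)
    show "compose (carrier P) f g x \<sqsubseteq> compose (carrier P) f g y"
      if "x \<in> carrier P" "y \<in> carrier P" "x \<sqsubseteq> y" for x y
      using M_iso[OF f M_car[OF g that(1)] M_car[OF g that(2)] M_iso[OF g that]] that
      by (simp add: compose_def)
  qed simp
  have id: "(\<lambda>x\<in>carrier P. x) \<in> M"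
    by (rule M_I) (auto simp: common_fixpoints_def)
  have dir: "directed_in P ((\<lambda>f. f x) ` M)" if x: "x \<in> carrier P" for x
    unfolding directed_in_def
  proof (intro conjI ballI)
    fix a b assume "a \<in> (\<lambda>f. f x) ` M" "b \<in> (\<lambda>f. f x) ` M"
    then obtain f g where fg: "f \<in> M" "g \<in> M" "a = f x" "b = g x" by auto
    have "compose (carrier P) f g x = f (g x)" using x by (simp add: compose_def)
    moreover have "f x \<sqsubseteq> f (g x)" "g x \<sqsubseteq> f (g x)"
      using M_iso[OF fg(1) x M_car[OF fg(2) x] M_asc[OF fg(2) x]]
        M_asc[OF fg(1) M_car[OF fg(2) x]] by simp_all
    ultimately show "\<exists>z\<in>(\<lambda>f. f x) ` M. a \<sqsubseteq> z \<and> b \<sqsubseteq> z"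
      using comp[OF fg(1,2)] fg by (metis imageI)
  qed (use id x M_car in auto)
  have lub: "is_lub P (h x) ((\<lambda>f. f x) ` M)" if x: "x \<in> carrier P" for x
    using someI_ex[OF directed_sup_exists[OF dir[OF x]]] x by (simp add: h_def)
  have h_car: "h x \<in> carrier P" if "x \<in> carrier P" for x
    using lub[OF that] by (rule least_closed)
  have h_ub: "f x \<sqsubseteq> h x" if "f \<in> M" "x \<in> carrier P" for f x
    using least_mem[OF lub[OF that(2)]] that M_car by (auto simp: Upper_def)
  have h_lst: "h x \<sqsubseteq> u"
    if "x \<in> carrier P" "u \<in> carrier P" "\<And>f. f \<in> M \<Longrightarrow> f x \<sqsubseteq> u" for x u
    using least_le[OF lub[OF that(1)], of u] that by (auto simp: Upper_def)
  have h_M: "h \<in> M"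
  proof (rule M_I)
    show "x \<sqsubseteq> h x" if "x \<in> carrier P" for x
      using h_ub[OF id that] that by simp
    show "h x \<sqsubseteq> h y" if "x \<in> carrier P" "y \<in> carrier P" "x \<sqsubseteq> y" for x y
    proof (rule h_lst)
      fix f assume f: "f \<in> M"
      show "f x \<sqsubseteq> h y"
        using le_trans[OF M_iso[OF f that] h_ub[OF f that(2)]] M_car[OF f] h_car that by simp
    qed (use that h_car in simp_all)
    show "h z = z" if z: "z \<in> ?F" for z
    proof (rule le_antisym)
      show "h z \<sqsubseteq> z" using z F_car[OF z] by (intro h_lst) (auto simp: M_def)
      show "z \<sqsubseteq> h z" using h_ub[OF id F_car[OF z]] F_car[OF z] by simp
    qed (use F_car[OF z] h_car in auto)
  qed (use h_car in \<open>auto simp: h_def\<close>)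
  have G_M: "g \<in> M" if "g \<in> G" for g
    using that G by (auto simp: M_def common_fixpoints_def)
  have h_F: "h x \<in> ?F" if x: "x \<in> carrier P" for x
    unfolding common_fixpoints_def
  proof (intro CollectI conjI ballI)
    fix g assume g: "g \<in> G"
    have "g (h x) \<sqsubseteq> h x"
      using h_ub[OF comp[OF G_M[OF g] h_M] x] x by (simp add: compose_def)
    then show "g (h x) = h x"
      using M_asc[OF G_M[OF g] h_car[OF x]] M_car[OF G_M[OF g] h_car[OF x]] h_car[OF x]
      by (intro le_antisym)
  qed (rule h_car[OF x])
  have h_fix: "h z = z" if "z \<in> ?F" for z
    using h_M that by (simp add: M_def)
  have "h \<in> closure_operators P"
    using h_M h_F h_fix
    by (auto simp: closure_operators_def M_def idempotent_def eq_is_equal)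
  moreover have "fps P h = ?F"
  proof
    show "fps P h \<subseteq> ?F" using h_F by (force simp: fps_def eq_is_equal)
    show "?F \<subseteq> fps P h" using h_fix F_car by (auto simp: fps_def eq_is_equal)
  qed
  ultimately show ?thesis by blast
qed

lemma generated_closure:
  assumes "G \<subseteq> preclosure_maps P"
  shows "generated_closure_operator P G \<in> closure_operators P"
    and "fps P (generated_closure_operator P G) = common_fixpoints P G"
proof -
  have "\<exists>!c. c \<in> closure_operators P \<and> fps P c = common_fixpoints P G"
    using ex_closure_operator_common_fixpoints[OF assms] closure_operator_eqI by metis
  from theI'[OF this]
  show "generated_closure_operator P G \<in> closure_operators P"
    and "fps P (generated_closure_operator P G) = common_fixpoints P G"
    unfolding generated_closure_operator_def by blast+
qed

end

end

(* For closure operators c and d one has c \<le> d pointwise iff fix(d) \<subseteq> fix(c), so Cl(P) is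
   dually isomorphic to ClSys(P).  Since common fixpoint sets of closure operators are again
   closure systems, ClSys(P) is closed under intersections, which are therefore its meets; the
   dual isomorphism turns them into joins of Cl(P). *)
theory Submission
  imports Defs
begin

text \<open>The meet of \<open>A\<close> is the join \<open>s\<close> of its lower bounds: every
  element of \<open>A\<close> is an upper bound of \<open>Lower L A\<close>, so leastness puts
  \<open>s\<close> below it.\<close>

lemma (in partial_order) complete_lattice_if_all_lubs:
  assumes lub: "\<And>A. A \<subseteq> carrier L \<Longrightarrow> \<exists>s. is_lub L s A"
  shows "complete_lattice L"
proof (rule complete_latticeI)
  fix A assume A: "A \<subseteq> carrier L"
  obtain s where s: "is_lub L s (Lower L A)"
    using lub[OF Lower_closed] by blast
  have "is_glb L s A"
  proof (rule greatest_LowerI)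
    show "s \<sqsubseteq> x" if "x \<in> A" for x
      using least_le[OF s] that A by (auto simp: Upper_def Lower_def)
    show "y \<sqsubseteq> s" if "y \<in> Lower L A" for y
      using least_Upper_above[OF s that] by simp
  qed (use A least_closed[OF s] in auto)
  then show "\<exists>i. is_glb L i A" ..
qed (rule lub)

lemma Cl_simps [simp]:
  "carrier (Cl P) = closure_operators P"
  "(.=\<^bsub>Cl P\<^esub>) = (=)"
  "c \<sqsubseteq>\<^bsub>Cl P\<^esub> d \<longleftrightarrow> (\<forall>x\<in>carrier P. c x \<sqsubseteq>\<^bsub>P\<^esub> d x)"
  by (simp_all add: Cl_def)

lemma ClSys_simps [simp]:
  "carrier (ClSys P) = closure_systems P"
  "(.=\<^bsub>ClSys P\<^esub>) = (=)"
  "C \<sqsubseteq>\<^bsub>ClSys P\<^esub> D \<longleftrightarrow> C \<subseteq> D"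
  by (simp_all add: ClSys_def)

lemma partial_order_ClSys: "partial_order (ClSys P)"
  by unfold_locales auto

context dcpo
begin

lemma Cl_le_iff_fps_subset:
  assumes c: "c \<in> closure_operators P" and d: "d \<in> closure_operators P"
  shows "c \<sqsubseteq>\<^bsub>Cl P\<^esub> d \<longleftrightarrow> fps P d \<subseteq> fps P c"
proof
  assume le: "c \<sqsubseteq>\<^bsub>Cl P\<^esub> d"
  have cp: "c \<in> preclosure_maps P"
    using c closure_operators_subset by blast
  show "fps P d \<subseteq> fps P c"
  proof
    fix x assume "x \<in> fps P d"
    then have x: "x \<in> carrier P" and "d x = x"
      by (auto simp: fps_def eq_is_equal)
    \<comment> \<open>At a fixpoint of \<open>d\<close> the value of \<open>c\<close> is squeezed:
      \<open>x \<sqsubseteq> c x \<sqsubseteq> d x = x\<close>.\<close>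
    then have "c x \<sqsubseteq> x" using le by force
    then have "c x = x"
      using preclosure_mapsD(2,3)[OF cp x] x by (intro le_antisym)
    then show "x \<in> fps P c" using x by (simp add: fps_def eq_is_equal)
  qed
next
  assume "fps P d \<subseteq> fps P c"
  then show "c \<sqsubseteq>\<^bsub>Cl P\<^esub> d" using closure_operator_le[OF c d] by simp
qed

text \<open>\<open>fps P\<close> is injective on closure operators and turns the pointwise order
  into reverse inclusion, so the order axioms are inherited from inclusion.
  \<open>Cl_simps(3)\<close> is removed to keep the order folded for that rewriting.\<close>

lemma partial_order_Cl: "partial_order (Cl P)"
  by unfold_locales
    (auto simp: Cl_le_iff_fps_subset simp del: Cl_simps(3) intro: closure_operator_eqI)

text \<open>A closure operator bounds \<open>G\<close> from above iff its fixpoint set lies in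
  \<open>fps P c\<close> for all \<open>c\<close> in \<open>G\<close>, that is, in
  \<open>common_fixpoints P G\<close>. The generated operator attains this set, hence is the least
  bound.\<close>

lemma is_lub_generated_closure_operator:
  assumes G: "G \<subseteq> closure_operators P"
  shows "is_lub (Cl P) (generated_closure_operator P G) G"
proof -
  let ?g = "generated_closure_operator P G"
  have "G \<subseteq> preclosure_maps P" using G closure_operators_subset by blast
  note g = generated_closure[OF this]
  have common: "S \<subseteq> common_fixpoints P G \<longleftrightarrow> (\<forall>c\<in>G. S \<subseteq> fps P c)"
    if "S \<subseteq> carrier P" for S
    using that by (auto simp: common_fixpoints_def fps_def eq_is_equal)
  show ?thesis
  proof (rule least_UpperI)
    show "c \<sqsubseteq>\<^bsub>Cl P\<^esub> ?g" if "c \<in> G" for c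
    proof -
      have "fps P ?g \<subseteq> fps P c"
        using common[OF fps_carrier, of ?g] that g(2) by blast
      then show ?thesis
        using Cl_le_iff_fps_subset[OF _ g(1)] that G by blast
    qed
    show "?g \<sqsubseteq>\<^bsub>Cl P\<^esub> d" if "d \<in> Upper (Cl P) G" for d
    proof -
      have d: "d \<in> closure_operators P" and "\<And>c. c \<in> G \<Longrightarrow> c \<sqsubseteq>\<^bsub>Cl P\<^esub> d"
        using that G unfolding Upper_def by auto
      then have "\<forall>c\<in>G. fps P d \<subseteq> fps P c"
        using G Cl_le_iff_fps_subset by blast
      then show ?thesis
        using common[of "fps P d"] d g by (simp add: Cl_le_iff_fps_subset del: Cl_simps(3))
    qed
  qed (use G g in auto)
qed

lemma intersection_in_closure_systems:
  assumes "\<C> \<subseteq> closure_systems P"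
  shows "intersection_in P \<C> \<in> closure_systems P"
proof -
  \<comment> \<open>Passing to the operators behind the members of \<open>\<C>\<close> turns the
    intersection into a common fixpoint set. For empty \<open>\<C>\<close> also \<open>?G\<close> is
    empty, and both sets are the carrier.\<close>
  let ?G = "{c \<in> closure_operators P. fps P c \<in> \<C>}"
  have "\<C> = fps P ` ?G" using assms by (auto simp: closure_systems_def)
  then have "intersection_in P \<C> = intersection_in P (fps P ` ?G)" by simp
  also have "\<dots> = common_fixpoints P ?G"
    by (auto simp: intersection_in_def common_fixpoints_def fps_def eq_is_equal)
  finally have eq: "intersection_in P \<C> = common_fixpoints P ?G" .
  have "?G \<subseteq> preclosure_maps P" using closure_operators_subset by blast
  \<comment> \<open>Directed completeness of \<open>P\<close> enters here: the operator is a
    pointwise directed join of the preclosure maps that fix all these points.\<close>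
  from ex_closure_operator_common_fixpoints[OF this]
  obtain c where "c \<in> closure_operators P" "fps P c = common_fixpoints P ?G"
    by blast
  then show ?thesis unfolding eq closure_systems_def by (intro image_eqI[where x = c]) simp_all
qed

lemma is_glb_intersection_in:
  assumes \<C>: "\<C> \<subseteq> closure_systems P"
  shows "is_glb (ClSys P) (intersection_in P \<C>) \<C>"
proof (rule greatest_LowerI)
  show "D \<sqsubseteq>\<^bsub>ClSys P\<^esub> intersection_in P \<C>" if "D \<in> Lower (ClSys P) \<C>" for D
  proof -
    have "D \<in> closure_systems P" "\<forall>C\<in>\<C>. D \<subseteq> C"
      using that \<C> by (auto simp: Lower_def)
    \<comment> \<open>Being a fixpoint set, \<open>D\<close> lies in the carrier;
      \<open>intersection_in\<close> demands this too, and nothing else when \<open>\<C>\<close> is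
      empty.\<close>
    then show ?thesis
      by (auto simp: intersection_in_def closure_systems_def fps_def)
  qed
qed (use \<C> intersection_in_closure_systems in \<open>auto simp: intersection_in_def\<close>)

lemma complete_lattice_Cl: "complete_lattice (Cl P)"
proof (rule partial_order.complete_lattice_if_all_lubs[OF partial_order_Cl])
  show "\<exists>s. is_lub (Cl P) s G" if "G \<subseteq> carrier (Cl P)" for G
    using is_lub_generated_closure_operator that unfolding Cl_simps by blast
qed

lemma complete_lattice_ClSys: "complete_lattice (ClSys P)"
proof (rule partial_order.complete_lattice_criterion1[OF partial_order_ClSys])
  \<comment> \<open>The criterion asks for a top element and for meets of nonempty families; the top
    is the empty meet, which is the whole carrier of \<open>P\<close>.\<close>
  show "\<exists>T. greatest (ClSys P) T (carrier (ClSys P))"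
    using is_glb_intersection_in[of "{}"] by auto
qed (use is_glb_intersection_in in auto)

end

theorem corollary3p3:
  fixes P :: "('a, 'b) gorder_scheme"
  assumes "dcpo P"
  shows "complete_lattice (Cl P) \<and> complete_lattice (ClSys P) \<and>
    (\<forall>G. G \<subseteq> carrier (Cl P) \<longrightarrow> is_lub (Cl P) (generated_closure_operator P G) G) \<and>
    (\<forall>\<C>. \<C> \<subseteq> carrier (ClSys P) \<longrightarrow> is_glb (ClSys P) (intersection_in P \<C>) \<C>)"
proof -
  interpret dcpo P by (rule assms)
  show ?thesis
    using complete_lattice_Cl complete_lattice_ClSys
      is_lub_generated_closure_operator is_glb_intersection_in by simp
qed

end
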